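(* Let $r$ be a positive integer, $p$ a probability with $1/2<p<1$, and $\mathcal T$ a list of $2^r$ teams with a team $t\in\mathcal T$ such that for every other team $s$, $\mathbb P[t\text{ beats }s]=p$. Let $\mathcal A$ be the balanced bracket on $2^r$ teams, let $\mathcal B$ be a bracket on $2^r-1$ teams such that the linear multibracket $\mathcal A\to\mathcal B$ is respectful, and let $\mathcal C$ be the double-elimination format with winners' bracket $\mathcal A$ and losers' bracket $\mathcal B$, with or without a recharge round. Then $$\mathbb W_{\mathcal C}(t,\mathcal T)\ \ge\ \mathbb W_{\mathcal A}(t,\mathcal T),$$ with equality only when $r=1$ and there is no recharge round.
   Context: Games have independent outcomes determined by the probabilities $\mathbb P[t_i\text{ beats }t_j]$. $\mathbb W_{\mathcal X}(t,\mathcal T)$ is the probability that team $t$ wins tournament format $\mathcal X$ run on the list of teams $\mathcal T$. A bracket is a full binary tree (children unordered) whose leaves are starting lines on which teams are placed; each internal node is a game between the teams arriving from its two children; the winner moves up and the loser leaves the bracket; the team reaching the root wins the bracket. If the height is $r$, there are $r$ rounds: the games at distance $d$ from the root form round $r-d$. The balanced bracket on $2^r$ teams is the one in which no team has a bye, i.e. all leaves are at distance $r$ from the root. The linear multibracket $\mathcal A\to\mathcal B$: all $2^r$ teams start in $\mathcal A$, and the $2^r-1$ starting lines of $\mathcal B$ are labelled bijectively by the $2^r-1$ games of $\mathcal A$, the loser of a game of $\mathcal A$ being placed on the starting line of $\mathcal B$ labelled by it; losers in $\mathcal B$ are eliminated. Respectfulness is defined through the flowchart of a linear multibracket $\mathcal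 A_1\to\cdots\to\mathcal A_k$ (here $k=2$, $\mathcal A_1=\mathcal A$, $\mathcal A_2=\mathcal B$), a directed graph with nodes in rows: row $0$ has the teams, from lowest seed (left) to highest seed (right); row $i$ ($1\le i\le k$) has the rounds of $\mathcal A_i$ in order from left to right, followed at the right end by a node for the place received by the winner of $\mathcal A_i$; the last row has a single node for elimination. There is an arrow from each team to the round where it plays its first game, and from each round $R$ to the round(s) where losers of $R$ play their next game (or to a place node if they win a bracket without playing another game, or to the elimination node if eliminated). The linear multibracket is respectful if every node has at most one arrow coming out of it and no arrows cross. Here lines are imagined to extend infinitely upward from teams, rightward from place nodes and downward from the elimination node, and an arrow that skips a row passes to the left of that row; explicitly, no crossings means: for any arrows $u\to v$ and $u'\to v'$ such that either $u,u'$ are in the same row with $u$ strictly left of $u'$, or $\mathrm{row}(u)<\mathrm{row}(u')<\mathrm{row}(v)$, one has $\mathrm{row}(v')<\mathrm{row}(v)$, or $\mathrm{row}(v')=\mathrm{row}(v)$ and $v'$ equals or is to the right of $v$. The double-elimination format with winners' bracket $\mathcal A$ and losers' bracket $\mathcal B$: all $2^r$ teams start in $\mathcal A$, which is played to completion; the loser of each game of $\mathcal A$ is placed on the starting line of $\mathcal B$ labelled by that game, $\mathcal B$ is played to completion, and teams losing in $\mathcal B$ are eliminated; then there is a grand finals in which the winner of $\mathcal A$ plays the winner of $\mathcal B$. With a recharge round: if the winner of $\mathcal A$ wins this game it is champion; otherwise the two teams play a second game, whose winner is champion (so the winner of $\mathcal B$ must win twice). Without a recharge round: the winner of the single grand finals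 game is champion. *)

theory Defs
  imports "HOL-Probability.Probability"
begin

text \<open>
  A full binary tree with labelled leaves (the starting lines). The children of a game are
  unordered in the mathematics; everything below except the naming of positions is invariant
  under exchanging the two arguments of \<open>Game\<close>.
\<close>

datatype 'a bracket = Line 'a | Game "'a bracket" "'a bracket"

text \<open>Positions in a bracket are paths from the root, so distance from the root is \<open>length\<close>.\<close>

primrec starting_lines :: "'a bracket \<Rightarrow> (bool list \<times> 'a) list" where
  "starting_lines (Line x) = [([], x)]"
| "starting_lines (Game l r) =
     map (apfst (Cons False)) (starting_lines l) @ map (apfst (Cons True)) (starting_lines r)"

primrec games :: "'a bracket \<Rightarrow> bool list set" where
  "games (Line x) = {}"
| "games (Game l r) = insert [] (Cons False ` games l \<union> Cons True ` games r)"

primrec height :: "'a bracket \<Rightarrow> nat" where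
  "height (Line x) = 0"
| "height (Game l r) = Suc (max (height l) (height r))"

definition round_of :: "'a bracket \<Rightarrow> bool list \<Rightarrow> nat" where
  "round_of b g = height b - length g"

definition labelled_by :: "'a bracket \<Rightarrow> 'a set \<Rightarrow> bool" where
  "labelled_by b S \<longleftrightarrow>
     distinct (map snd (starting_lines b)) \<and> set (map snd (starting_lines b)) = S"

text \<open>
  The starting lines of a first bracket on \<open>n\<close> teams are labelled by \<open>0, \<dots>, n - 1\<close>: line \<open>i\<close>
  receives the \<open>i\<close>-th entry of the list of teams (the team with seed number \<open>i + 1\<close>).
\<close>

definition balanced_bracket :: "nat \<Rightarrow> nat bracket \<Rightarrow> bool" where
  "balanced_bracket r A \<longleftrightarrow>
     labelled_by A {..<2 ^ r} \<and> (\<forall>(q, i) \<in> set (starting_lines A). length q = r)"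

definition linear_multibracket :: "nat bracket \<Rightarrow> bool list bracket \<Rightarrow> bool" where
  "linear_multibracket A B \<longleftrightarrow> labelled_by B (games A)"


text \<open>
  \<open>Round k j\<close> is round \<open>j\<close> of the \<open>k\<close>-th bracket and \<open>Place k\<close> the place received by its winner;
  the brackets are \<open>A\<close> (\<open>k = 1\<close>) and \<open>B\<close> (\<open>k = 2\<close>).
\<close>

datatype node = Team nat | Round nat nat | Place nat | Elimination

primrec row :: "node \<Rightarrow> nat" where
  "row (Team i) = 0"
| "row (Round k j) = k"
| "row (Place k) = k"
| "row Elimination = 3"

text \<open>
  Horizontal order within a row. Team \<open>0\<close> has the highest seed, so it is the rightmost team.
\<close>

inductive left_of :: "node \<Rightarrow> node \<Rightarrow> bool" where
  "j < i \<Longrightarrow> left_of (Team i) (Team j)"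
| "i < j \<Longrightarrow> left_of (Round k i) (Round k j)"
| "left_of (Round k i) (Place k)"

text \<open>
  Where a team entering the \<open>k\<close>-th bracket \<open>b\<close> on the starting line at position \<open>q\<close> plays first:
  that game is the parent of the line, unless the line is the whole bracket.
\<close>

definition entry_node :: "nat \<Rightarrow> 'a bracket \<Rightarrow> bool list \<Rightarrow> node" where
  "entry_node k b q = (if q = [] then Place k else Round k (round_of b (butlast q)))"

inductive arrow :: "nat bracket \<Rightarrow> bool list bracket \<Rightarrow> node \<Rightarrow> node \<Rightarrow> bool"
  for A :: "nat bracket" and B :: "bool list bracket" where
  "(q, i) \<in> set (starting_lines A) \<Longrightarrow> arrow A B (Team i) (entry_node 1 A q)"
| "g \<in> games A \<Longrightarrow> (q, g) \<in> set (starting_lines B) \<Longrightarrow>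
     arrow A B (Round 1 (round_of A g)) (entry_node 2 B q)"
| "g \<in> games B \<Longrightarrow> arrow A B (Round 2 (round_of B g)) Elimination"

definition respectful :: "nat bracket \<Rightarrow> bool list bracket \<Rightarrow> bool" where
  "respectful A B \<longleftrightarrow>
     (\<forall>u v v'. arrow A B u v \<longrightarrow> arrow A B u v' \<longrightarrow> v = v') \<and>
     (\<forall>u v u' v'. arrow A B u v \<longrightarrow> arrow A B u' v' \<longrightarrow>
        (row u = row u' \<and> left_of u u' \<or> row u < row u' \<and> row u' < row v) \<longrightarrow>
        (row v' < row v \<or> row v' = row v \<and> (v' = v \<or> left_of v v')))"


text \<open>
  \<open>P a b\<close> is the probability that \<open>a\<close> beats \<open>b\<close>. There are no ties, and the value \<open>P a a\<close> is
  irrelevant.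
\<close>

definition matchup_probabilities :: "('t \<Rightarrow> 't \<Rightarrow> real) \<Rightarrow> 't set \<Rightarrow> bool" where
  "matchup_probabilities P S \<longleftrightarrow>
     (\<forall>a\<in>S. \<forall>b\<in>S. a \<noteq> b \<longrightarrow> 0 \<le> P a b \<and> P a b \<le> 1 \<and> P a b + P b a = 1)"

text \<open>
  Playing a bracket whose starting lines carry teams: the joint distribution of the winner and of
  the map from games to their losers. Every game draws a fresh Bernoulli variable.
\<close>

primrec play :: "('t \<Rightarrow> 't \<Rightarrow> real) \<Rightarrow> 't bracket \<Rightarrow> ('t \<times> (bool list \<rightharpoonup> 't)) pmf" where
  "play P (Line x) = return_pmf (x, Map.empty)"
| "play P (Game l r) = do {
     (a, f) \<leftarrow> play P l;
     (b, h) \<leftarrow> play P r;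
     a_wins \<leftarrow> bernoulli_pmf (P a b);
     return_pmf
       (if a_wins then a else b,
        \<lambda>g. case g of
              [] \<Rightarrow> Some (if a_wins then b else a)
            | d # g' \<Rightarrow> if d then h g' else f g')
   }"

text \<open>A tournament format maps the list of teams to the distribution of the champion.\<close>

definition bracket_format :: "('t \<Rightarrow> 't \<Rightarrow> real) \<Rightarrow> nat bracket \<Rightarrow> 't list \<Rightarrow> 't pmf" where
  "bracket_format P A T = map_pmf fst (play P (map_bracket (\<lambda>i. T ! i) A))"

definition match :: "('t \<Rightarrow> 't \<Rightarrow> real) \<Rightarrow> 't \<Rightarrow> 't \<Rightarrow> 't pmf" where
  "match P a b = map_pmf (\<lambda>a_wins. if a_wins then a else b) (bernoulli_pmf (P a b))"

definition grand_finals :: "('t \<Rightarrow> 't \<Rightarrow> real) \<Rightarrow> bool \<Rightarrow> 't \<Rightarrow> 't \<Rightarrow> 't pmf" where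
  "grand_finals P recharge a b = do {
     x \<leftarrow> match P a b;
     if recharge \<and> x \<noteq> a then match P a b else return_pmf x
   }"

definition double_elimination ::
  "('t \<Rightarrow> 't \<Rightarrow> real) \<Rightarrow> bool \<Rightarrow> nat bracket \<Rightarrow> bool list bracket \<Rightarrow> 't list \<Rightarrow> 't pmf" where
  "double_elimination P recharge A B T = do {
     (a, loser) \<leftarrow> play P (map_bracket (\<lambda>i. T ! i) A);
     (b, _) \<leftarrow> play P (map_bracket (\<lambda>g. the (loser g)) B);
     grand_finals P recharge a b
   }"

definition win_prob :: "('t list \<Rightarrow> 't pmf) \<Rightarrow> 't \<Rightarrow> 't list \<Rightarrow> real" where
  "win_prob X t T = pmf (X T) t"

end

theory Submission
  imports Defs
begin

text \<open>
  The team \<open>t\<close> wins \<open>A\<close> with probability \<open>p ^ r\<close>, and with probability \<open>p ^ k * (1 - p)\<close> it loses its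
  game of round \<open>k + 1\<close>. As every round of \<open>A\<close> has a single outgoing arrow, the depth in \<open>B\<close> of the
  line labelled by a game of \<open>A\<close> depends only on the distance \<open>j\<close> of that game from the root; call
  it \<open>dep j\<close>. From there \<open>t\<close> wins \<open>B\<close> with probability \<open>p ^ dep j\<close>. Kraft's equality for the leaves
  of \<open>B\<close> is \<open>(\<Sum>j<r. 2 ^ j * (1 / 2) ^ dep j) = 1\<close>, that is,
  \<open>(\<Sum>j<r. (1 / 2) ^ (r - 1 - j + dep j)) = (1 / 2) ^ (r - 1)\<close>. Replacing \<open>1 / 2\<close> by \<open>p > 1 / 2\<close>
  turns this into \<open>(\<Sum>j<r. p ^ (r - 1 - j + dep j)) \<ge> p ^ (r - 1)\<close>, strictly if there are at least
  two terms, and the left side times \<open>(1 - p) * p\<close> is what the losers' bracket contributes without a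
  recharge round.
\<close>

section \<open>Brackets as labelled trees and the outcomes of playing them\<close>

lemma starting_lines_map_bracket:
  "starting_lines (map_bracket h b) = map (map_prod id h) (starting_lines b)"
  by (induction b) (auto simp: apfst_def map_prod_def split_beta)

lemma games_map_bracket: "games (map_bracket h b) = games b"
  by (induction b) simp_all

lemma snd_starting_lines_Game:
  "map snd (starting_lines (Game l r)) = map snd (starting_lines l) @ map snd (starting_lines r)"
  by (simp add: comp_def)

lemma set_bracket_eq_lines: "set_bracket b = set (map snd (starting_lines b))"
  by (induction b) (auto simp: image_Un image_image)

lemma line_in_set_bracket: "(q, x) \<in> set (starting_lines b) \<Longrightarrow> x \<in> set_bracket b"
  by (force simp: set_bracket_eq_lines)

lemma ex_bool_list: "(\<exists>g. Q g) \<longleftrightarrow> Q [] \<or> (\<exists>g. Q (False # g)) \<or> (\<exists>g. Q (True # g))"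
proof
  assume "\<exists>g. Q g"
  then obtain g where g: "Q g" ..
  show "Q [] \<or> (\<exists>g. Q (False # g)) \<or> (\<exists>g. Q (True # g))"
  proof (cases g)
    case (Cons d g')
    with g show ?thesis by (cases d) auto
  qed (use g in simp)
qed auto

lemma length_line_le_height: "(q, x) \<in> set (starting_lines b) \<Longrightarrow> length q \<le> height b"
  by (induction b arbitrary: q) (auto simp: le_max_iff_disj)

text \<open>Below a new root every line is one step deeper, so each child's sum is halved and the
  two halves add up to 1. As the sum is nonzero, a bracket always has a starting line.\<close>

lemma kraft_sum_starting_lines: "(\<Sum>(q, x) \<leftarrow> starting_lines b. (1 / 2 :: real) ^ length q) = 1"
proof (induction b)
  case (Game l r)
  have *: "(\<Sum>x\<leftarrow>xs. case apfst (Cons d) x of (q, x) \<Rightarrow> (1 / 2 :: real) ^ length q)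
      = (\<Sum>(q, x)\<leftarrow>xs. (1 / 2) ^ length q) / 2" for d and xs :: "(bool list \<times> 'b) list"
    by (induction xs) (auto simp: add_divide_distrib)
  show ?case
    using Game by (simp add: comp_def *)
qed simp

lemma games_uniform_depth:
  assumes "\<And>q x. (q, x) \<in> set (starting_lines b) \<Longrightarrow> length q = r"
  shows "games b = {g. length g < r} \<and> height b = r"
  using assms
proof (induction b arbitrary: r)
  case (Game b1 b2)
  \<comment> \<open>A line of the left child has depth at least 1 in the whole bracket, so
    \<open>r\<close> is a successor; all lines of either child then have depth \<open>r'\<close> in
    that child.\<close>
  have "starting_lines b1 \<noteq> []"
    using kraft_sum_starting_lines[of b1] by auto
  then obtain q0 x0 where q0: "(q0, x0) \<in> set (starting_lines b1)"
    by (metis list.set_sel(1) surj_pair)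
  have "length (False # q0) = r"
    using q0 by (intro Game.prems[of _ x0]) force
  then obtain r' where r: "r = Suc r'"
    by auto
  have 1: "games b1 = {g. length g < r'} \<and> height b1 = r'"
  proof (rule Game.IH(1))
    fix q x assume "(q, x) \<in> set (starting_lines b1)"
    then have "length (False # q) = r"
      by (intro Game.prems[of _ x]) force
    then show "length q = r'" using r by simp
  qed
  have 2: "games b2 = {g. length g < r'} \<and> height b2 = r'"
  proof (rule Game.IH(2))
    fix q x assume "(q, x) \<in> set (starting_lines b2)"
    then have "length (True # q) = r"
      by (intro Game.prems[of _ x]) force
    then show "length q = r'" using r by simp
  qed
  have "g \<in> games (Game b1 b2) \<longleftrightarrow> length g < r" for g
  proof (cases g)
    case (Cons d g')
    then show ?thesis using 1 2 r by (cases d) (auto simp: image_iff)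
  qed (simp add: r)
  then have "games (Game b1 b2) = {g. length g < r}"
    by blast
  moreover have "height (Game b1 b2) = r"
    using 1 2 r by simp
  ultimately show ?case ..
qed auto

text \<open>Every team but the winner leaves the bracket by losing exactly one game, so
  \<open>f\<close> is a bijection from the games to these teams. This makes the teams placed in the
  losers' bracket pairwise distinct.\<close>

lemma play_support:
  assumes "distinct (map snd (starting_lines b))" and "(a, f) \<in> set_pmf (play P b)"
  shows "a \<in> set_bracket b \<and> dom f = games b \<and> ran f = set_bracket b - {a} \<and> inj_on f (dom f)"
  using assms
proof (induction b arbitrary: a f)
  case (Game l r)
  obtain x y w where xyw: "x \<in> set_pmf (play P l)" "y \<in> set_pmf (play P r)"
    "a = (if w then fst x else fst y)"
    "f = (\<lambda>g. case g of [] \<Rightarrow> Some (if w then fst y else fst x) | d # g' \<Rightarrow> if d then snd y g' else snd x g')"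
    using Game.prems(2)
    by (simp only: play.simps set_bind_pmf split_beta set_return_pmf UN_iff singleton_iff prod.inject)
      (elim bexE conjE, rule that)
  obtain a1 f1 a2 f2 where 1: "(a1, f1) \<in> set_pmf (play P l)" and 2: "(a2, f2) \<in> set_pmf (play P r)"
    and a: "a = (if w then a1 else a2)"
    and f: "f = (\<lambda>g. case g of [] \<Rightarrow> Some (if w then a2 else a1) | d # g' \<Rightarrow> if d then f2 g' else f1 g')"
    using xyw by (intro that[of "fst x" "snd x" "fst y" "snd y"]) simp_all
  have d: "distinct (map snd (starting_lines l))" "distinct (map snd (starting_lines r))"
    and disj: "set_bracket l \<inter> set_bracket r = {}"
    using Game.prems(1) unfolding snd_starting_lines_Game set_bracket_eq_lines by auto
  note IH1 = Game.IH(1)[OF d(1) 1] and IH2 = Game.IH(2)[OF d(2) 2]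
  have f_Nil: "f [] = Some (if w then a2 else a1)" and f_F: "f (False # g) = f1 g"
    and f_T: "f (True # g) = f2 g" for g
    by (auto simp: f)
  have dom12: "(\<exists>s. f1 g = Some s) \<longleftrightarrow> g \<in> games l" "(\<exists>s. f2 g = Some s) \<longleftrightarrow> g \<in> games r" for g
    using IH1 IH2 domIff not_None_eq by metis+
  have dom: "dom f = games (Game l r)"
  proof (rule set_eqI)
    fix g show "g \<in> dom f \<longleftrightarrow> g \<in> games (Game l r)"
    proof (cases g)
      case (Cons d g')
      then show ?thesis by (cases d) (auto simp: f_F f_T dom_def dom12)
    qed (simp add: f_Nil dom_def)
  qed
  have "ran f = insert (if w then a2 else a1) (ran f1 \<union> ran f2)"
  proof (rule set_eqI)
    fix s
    have "s \<in> ran f \<longleftrightarrow> f [] = Some s \<or> (\<exists>g. f (False # g) = Some s) \<or> (\<exists>g. f (True # g) = Some s)"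
      unfolding ran_def mem_Collect_eq by (rule ex_bool_list)
    then show "s \<in> ran f \<longleftrightarrow> s \<in> insert (if w then a2 else a1) (ran f1 \<union> ran f2)"
      unfolding f_Nil f_F f_T by (auto simp: ran_def)
  qed
  then have ran: "ran f = set_bracket (Game l r) - {a}"
    using IH1 IH2 disj a by auto
  have ran1: "f1 g = Some s \<Longrightarrow> s \<in> set_bracket l \<and> s \<noteq> a1"
    and ran2: "f2 g = Some s \<Longrightarrow> s \<in> set_bracket r \<and> s \<noteq> a2" for g s
    using IH1 IH2 ranI by fast+
  have inj1: "f1 g = Some s \<Longrightarrow> f1 g' = Some s \<Longrightarrow> g = g'"
    and inj2: "f2 g = Some s \<Longrightarrow> f2 g' = Some s \<Longrightarrow> g = g'" for g g' s
    using IH1 IH2 by (metis domI inj_onD)+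
  \<comment> \<open>The loser at the root has won its half, so it is not among the losers of that
    half, and the halves share no team. Hence a team determines which of the three cases its loss
    falls under, and injectivity reduces to that of \<open>f1\<close> and \<open>f2\<close>.\<close>
  have f_cases: "(g = [] \<and> s = (if w then a2 else a1)) \<or>
      (\<exists>g'. g = False # g' \<and> f1 g' = Some s \<and> s \<in> set_bracket l \<and> s \<noteq> a1) \<or>
      (\<exists>g'. g = True # g' \<and> f2 g' = Some s \<and> s \<in> set_bracket r \<and> s \<noteq> a2)"
    if "f g = Some s" for g s
  proof (cases g)
    case (Cons d g')
    then show ?thesis
      using that ran1[of g' s] ran2[of g' s] by (cases d) (auto simp: f_F f_T)
  qed (use that in \<open>simp add: f_Nil\<close>)
  have "a1 \<in> set_bracket l" "a2 \<in> set_bracket r"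
    using IH1 IH2 by auto
  then have "g = g'" if "f g = Some s" "f g' = Some s" for g g' s
    using f_cases[OF that(1)] f_cases[OF that(2)] disj inj1 inj2
    by (elim disjE exE conjE) (auto split: if_splits)
  then have "inj_on f (dom f)"
    by (auto simp: inj_on_def)
  then show ?case
    using dom ran IH1 IH2 a by auto
qed (auto simp: ran_def)

lemma play_no_losses_iff:
  assumes "distinct (map snd (starting_lines b))" and "(a, f) \<in> set_pmf (play P b)"
    and "t \<in> set_bracket b"
  shows "{g. f g = Some t} = {} \<longleftrightarrow> a = t"
proof -
  have "{g. f g = Some t} = {} \<longleftrightarrow> t \<notin> ran f"
    by (auto simp: ran_def)
  then show ?thesis
    using play_support[OF assms(1,2)] assms(3) by auto
qed

section \<open>The law of the games lost by one team\<close>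

lemma bernoulli_pmf_eqI:
  assumes "0 \<le> x" "x \<le> 1" "pmf M True = x"
  shows "M = bernoulli_pmf x"
proof (rule pmf_eqI)
  fix w
  have "pmf M True + pmf M False = 1"
    using sum_pmf_eq_1[OF finite subset_UNIV, of M] by (simp add: UNIV_bool)
  then show "pmf M w = pmf (bernoulli_pmf x) w"
    using assms by (cases w) auto
qed

lemma pmf_map_eq_True: "pmf (map_pmf (\<lambda>x. x = t) M) True = pmf M t"
proof -
  have "(\<lambda>x. x = t) -` {True} = {t}" by auto
  then show ?thesis by (simp add: pmf_map measure_pmf_single)
qed

lemma pmf_bernoulli_bind:
  "0 \<le> x \<Longrightarrow> x \<le> 1 \<Longrightarrow>
    pmf (bernoulli_pmf x \<bind> K) y = x * pmf (K True) y + (1 - x) * pmf (K False) y"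
  by (simp add: pmf_bind)

lemma bernoulli_pmf_complement:
  "0 \<le> x \<Longrightarrow> x \<le> 1 \<Longrightarrow> bernoulli_pmf (1 - x) = map_pmf Not (bernoulli_pmf x)"
  by (rule bernoulli_pmf_eqI[symmetric])
    (simp_all add: map_pmf_def pmf_bernoulli_bind)

text \<open>
  The law of the set of games lost by a team that starts at position \<open>q\<close> and wins each of its games
  with probability \<open>p\<close>: this set is empty if the team wins the bracket and a singleton otherwise.
\<close>

primrec loss_pmf :: "real \<Rightarrow> bool list \<Rightarrow> bool list set pmf" where
  "loss_pmf p [] = return_pmf {}"
| "loss_pmf p (d # q) = do {
     S \<leftarrow> loss_pmf p q;
     if S = {} then map_pmf (\<lambda>w. if w then {} else {[]}) (bernoulli_pmf p)
     else return_pmf (Cons d ` S)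
   }"

text \<open>The lost game is at distance \<open>k\<close> from the root exactly if the team wins the
  \<open>length q - Suc k\<close> games below it on its path and loses the next one, at position
  \<open>take k q\<close>. With an arbitrary continuation \<open>K\<close> the formula also serves
  when a losers' bracket follows.\<close>

lemma pmf_bind_loss_pmf:
  assumes "0 \<le> p" "p \<le> 1"
  shows "pmf (loss_pmf p q \<bind> K) y = p ^ length q * pmf (K {}) y
    + (\<Sum>k<length q. p ^ (length q - Suc k) * (1 - p) * pmf (K {take k q}) y)"
proof (induction q arbitrary: K)
  case Nil
  then show ?case by (simp add: bind_return_pmf)
next
  case (Cons d q)
  \<comment> \<open>The game at the root is played last, so it is absorbed into the continuation, to
    which the induction hypothesis then applies.\<close>
  let ?K = "\<lambda>S. if S = {} then bernoulli_pmf p \<bind> (\<lambda>w. K (if w then {} else {[]})) else K (Cons d ` S)"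
  have "loss_pmf p (d # q) \<bind> K = loss_pmf p q \<bind> ?K"
    by (auto simp: bind_assoc_pmf bind_map_pmf bind_return_pmf intro!: bind_pmf_cong)
  then have "pmf (loss_pmf p (d # q) \<bind> K) y = p ^ length q * pmf (?K {}) y
    + (\<Sum>k<length q. p ^ (length q - Suc k) * (1 - p) * pmf (?K {take k q}) y)"
    by (simp only: Cons.IH)
  also have "\<dots> = p ^ length q * (p * pmf (K {}) y + (1 - p) * pmf (K {[]}) y)
    + (\<Sum>k<length q. p ^ (length q - Suc k) * (1 - p) * pmf (K {d # take k q}) y)"
    using assms by (simp add: pmf_bernoulli_bind)
  also have "\<dots> = p ^ length (d # q) * pmf (K {}) y
    + (\<Sum>k<length (d # q). p ^ (length (d # q) - Suc k) * (1 - p) * pmf (K {take k (d # q)}) y)"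
    \<comment> \<open>The index shift splits off \<open>k = 0\<close>, the loss at the root.\<close>
    unfolding length_Cons sum.lessThan_Suc_shift by (simp add: algebra_simps del: sum.lessThan_Suc)
  finally show ?case .
qed

text \<open>Whoever the opponent turns out to be, \<open>t\<close> beats it with probability
  \<open>p\<close>, so the results of the other games do not influence which game \<open>t\<close>
  loses. \<open>P s t\<close> is prescribed as well because \<open>t\<close> may come from the
  second child, while the draw is for the first.\<close>

lemma map_play_losses:
  fixes t :: 't
  assumes "distinct (map snd (starting_lines b))" and "(q, t) \<in> set (starting_lines b)"
    and "\<And>s. s \<in> set_bracket b \<Longrightarrow> s \<noteq> t \<Longrightarrow> P t s = p \<and> P s t = 1 - p"
    and "0 \<le> p" "p \<le> 1"
  shows "map_pmf (\<lambda>(a, f). {g. f g = Some t}) (play P b) = loss_pmf p q"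
  using assms(1-3)
proof (induction b arbitrary: q)
  case (Line x)
  then show ?case by simp
next
  case (Game l r)
  let ?L = "\<lambda>f :: bool list \<rightharpoonup> 't. {g. f g = Some t}"
  let ?K = "\<lambda>d S. if S = {} then map_pmf (\<lambda>w. if w then {} else {[]}) (bernoulli_pmf p)
     else return_pmf (Cons d ` S) :: bool list set pmf"
  have d: "distinct (map snd (starting_lines l))" "distinct (map snd (starting_lines r))"
    and disj: "set_bracket l \<inter> set_bracket r = {}"
    using Game.prems(1) unfolding snd_starting_lines_Game set_bracket_eq_lines by auto
  define R where "R = (\<lambda>(a, f) (b, h). bernoulli_pmf (P a b) \<bind> (\<lambda>w. return_pmf
     (?L (\<lambda>g. case g of [] \<Rightarrow> Some (if w then b else a) | d # g' \<Rightarrow> if d then h g' else f g'))))"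
  have play: "map_pmf (\<lambda>(a, f). ?L f) (play P (Game l r)) = play P l \<bind> (\<lambda>x. play P r \<bind> R x)"
    by (simp add: map_bind_pmf R_def split_beta cong: bind_pmf_cong)
  have L_case: "?L (\<lambda>g. case g of [] \<Rightarrow> Some (if w then b else a) | d # g' \<Rightarrow> if d then h g' else f g')
    = (if (if w then b else a) = t then {[]} else {}) \<union> Cons False ` ?L f \<union> Cons True ` ?L h" for w a b f h
  proof (rule set_eqI)
    fix g show "g \<in> ?L (\<lambda>g. case g of [] \<Rightarrow> Some (if w then b else a) | d # g' \<Rightarrow> if d then h g' else f g')
      \<longleftrightarrow> g \<in> (if (if w then b else a) = t then {[]} else {}) \<union> Cons False ` ?L f \<union> Cons True ` ?L h"
    proof (cases g)
      case (Cons d g')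
      then show ?thesis by (cases d) auto
    qed auto
  qed
  \<comment> \<open>\<open>supp\<close> is meant for the half that contains \<open>t\<close>,
    \<open>supp'\<close> for the other half.\<close>
  have supp: "(a = t \<longleftrightarrow> ?L f = {}) \<and> a \<in> set_bracket b"
    if "(a, f) \<in> set_pmf (play P b)" "distinct (map snd (starting_lines b))" "t \<in> set_bracket b" for a f b
    using play_no_losses_iff[OF that(2,1,3)] play_support[OF that(2,1)] by simp
  have supp': "a \<noteq> t \<and> ?L f = {} \<and> a \<in> set_bracket b"
    if "(a, f) \<in> set_pmf (play P b)" "distinct (map snd (starting_lines b))" "t \<notin> set_bracket b" for a f b
    using play_support[OF that(2,1)] that(3) ranI[of f _ t] by auto
  consider (F) q' where "q = False # q'" "(q', t) \<in> set (starting_lines l)"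
    | (T) q' where "q = True # q'" "(q', t) \<in> set (starting_lines r)"
    using Game.prems(2) by auto
  then show ?case
  proof cases
    case F
    then have t: "t \<in> set_bracket l" "t \<notin> set_bracket r"
      using disj by (auto dest: line_in_set_bracket)
    \<comment> \<open>The right-hand side does not mention \<open>y\<close>, so the play of the
      right half integrates out.\<close>
    have "R x y = ?K False (case x of (a, f) \<Rightarrow> ?L f)"
      if "x \<in> set_pmf (play P l)" "y \<in> set_pmf (play P r)" for x y
    proof -
      obtain a f b h where xy: "x = (a, f)" "y = (b, h)" by (cases x, cases y)
      note sl = supp[OF that(1)[unfolded xy] d(1) t(1)]
      note sr = supp'[OF that(2)[unfolded xy] d(2) t(2)]
      show ?thesis
      proof (cases "a = t")
        case True
        then have "P a b = p" using Game.prems(3) sr by simp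
        then show ?thesis
          unfolding R_def xy prod.case L_case using True sl sr
          by (auto simp: map_pmf_def intro!: bind_pmf_cong)
      next
        case False
        have "(if w then b else a) = t \<longleftrightarrow> False" for w
          using False sr by simp
        moreover have "?L f \<noteq> {}" "?L h = {}"
          using False sl sr by auto
        ultimately show ?thesis
          unfolding R_def xy prod.case L_case by (simp only: if_False) simp
      qed
    qed
    then have "play P l \<bind> (\<lambda>x. play P r \<bind> R x)
        = play P l \<bind> (\<lambda>x. play P r \<bind> (\<lambda>y. ?K False (case x of (a, f) \<Rightarrow> ?L f)))"
      by (intro bind_pmf_cong) auto
    also have "\<dots> = map_pmf (\<lambda>(a, f). ?L f) (play P l) \<bind> ?K False"
      by (simp add: bind_map_pmf)
    also have "map_pmf (\<lambda>(a, f). ?L f) (play P l) = loss_pmf p q'"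
      using Game.prems(3) by (intro Game.IH(1) d F(2)) auto
    finally show ?thesis
      unfolding play F(1) by simp
  next
    case T
    then have t: "t \<in> set_bracket r" "t \<notin> set_bracket l"
      using disj by (auto dest: line_in_set_bracket)
    have "R x y = ?K True (case y of (a, f) \<Rightarrow> ?L f)"
      if "x \<in> set_pmf (play P l)" "y \<in> set_pmf (play P r)" for x y
    proof -
      obtain a f b h where xy: "x = (a, f)" "y = (b, h)" by (cases x, cases y)
      note sl = supp'[OF that(1)[unfolded xy] d(1) t(2)]
      note sr = supp[OF that(2)[unfolded xy] d(2) t(1)]
      show ?thesis
      proof (cases "b = t")
        case True
        \<comment> \<open>The draw decides whether the opponent \<open>a\<close> wins, so the
          success of \<open>t\<close> is its negation.\<close>
        then have "P a b = 1 - p" using Game.prems(3) sl by simp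
        then show ?thesis
          unfolding R_def xy prod.case L_case using True sl sr assms(4,5)
          by (auto simp: bernoulli_pmf_complement map_pmf_def bind_assoc_pmf bind_return_pmf
              intro!: bind_pmf_cong)
      next
        case False
        have "(if w then b else a) = t \<longleftrightarrow> False" for w
          using False sl by simp
        moreover have "?L h \<noteq> {}" "?L f = {}"
          using False sl sr by auto
        ultimately show ?thesis
          unfolding R_def xy prod.case L_case by (simp only: if_False) simp
      qed
    qed
    then have "play P l \<bind> (\<lambda>x. play P r \<bind> R x)
        = play P l \<bind> (\<lambda>x. play P r \<bind> (\<lambda>y. ?K True (case y of (a, f) \<Rightarrow> ?L f)))"
      by (intro bind_pmf_cong) auto
    also have "\<dots> = map_pmf (\<lambda>(a, f). ?L f) (play P r) \<bind> ?K True"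
      by (simp add: bind_map_pmf)
    also have "map_pmf (\<lambda>(a, f). ?L f) (play P r) = loss_pmf p q'"
      using Game.prems(3) by (intro Game.IH(2) d T(2)) auto
    finally show ?thesis
      unfolding play T(1) by simp
  qed
qed

text \<open>Winning means losing no game, so the law of the lost games leaves just the two
  continuations \<open>L\<close> and \<open>M\<close>. This yields the chance of \<open>t\<close> to
  win \<open>A\<close> and, from a given line, to win the losers' bracket.\<close>

lemma play_bind_winner:
  assumes "distinct (map snd (starting_lines b))" and "(q, t) \<in> set (starting_lines b)"
    and "\<And>s. s \<in> set_bracket b \<Longrightarrow> s \<noteq> t \<Longrightarrow> P t s = p \<and> P s t = 1 - p"
    and "0 \<le> p" "p \<le> 1"
    and "\<And>a f. (a, f) \<in> set_pmf (play P b) \<Longrightarrow> K a = (if a = t then L else M)"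
  shows "pmf (play P b \<bind> (\<lambda>(a, _). K a)) y = p ^ length q * pmf L y + (1 - p ^ length q) * pmf M y"
proof -
  have t: "t \<in> set_bracket b"
    using assms(2) by (rule line_in_set_bracket)
  have loss: "loss_pmf p q = map_pmf (\<lambda>(a, f). {g. f g = Some t}) (play P b)"
    using assms by (intro map_play_losses[symmetric]) auto
  have eq: "play P b \<bind> (\<lambda>(a, _). K a) = loss_pmf p q \<bind> (\<lambda>S. if S = {} then L else M)"
    if "\<And>a f. (a, f) \<in> set_pmf (play P b) \<Longrightarrow> K a = (if a = t then L else M)" for K L M
    unfolding loss bind_map_pmf
  proof (intro bind_pmf_cong refl)
    fix x assume x: "x \<in> set_pmf (play P b)"
    show "(case x of (a, _) \<Rightarrow> K a) = (if (case x of (a, f) \<Rightarrow> {g. f g = Some t}) = {} then L else M)"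
      using play_no_losses_iff[OF assms(1) _ t, of "fst x" "snd x" P] that[of "fst x" "snd x"] x
      by (simp add: split_beta)
  qed
  \<comment> \<open>A constant continuation has total probability 1, which evaluates the geometric
    sum.\<close>
  have "1 = pmf (loss_pmf p q \<bind> (\<lambda>S. if S = {} then return_pmf True else return_pmf True)) True"
    by simp
  also have "\<dots> = p ^ length q + (\<Sum>k<length q. p ^ (length q - Suc k) * (1 - p))"
    unfolding pmf_bind_loss_pmf[OF assms(4,5)] by simp
  finally have sum: "(\<Sum>k<length q. p ^ (length q - Suc k) * (1 - p)) = 1 - p ^ length q"
    by simp
  have "play P b \<bind> (\<lambda>(a, _). K a) = loss_pmf p q \<bind> (\<lambda>S. if S = {} then L else M)"
    using assms(6) by (rule eq)
  then show ?thesis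
    by (simp add: sum pmf_bind_loss_pmf[OF assms(4,5)]
        flip: sum_distrib_right[of "\<lambda>k. p ^ (length q - Suc k) * (1 - p)"])
qed

section \<open>The grand finals, and an inequality for sums of powers\<close>

lemma pmf_grand_finals_unbeaten:
  assumes "0 \<le> P t s" "P t s \<le> 1" "P s t = 1 - P t s" "s \<noteq> t"
  shows "pmf (grand_finals P recharge t s) t
    = (if recharge then 1 - (1 - P t s)\<^sup>2 else P t s)"
  using assms
  by (simp add: grand_finals_def match_def map_pmf_def pmf_bernoulli_bind bind_assoc_pmf
      bind_return_pmf) (simp add: power2_eq_square algebra_simps)

lemma pmf_grand_finals_once_beaten:
  assumes "0 \<le> P t s" "P t s \<le> 1" "P s t = 1 - P t s" "s \<noteq> t"
  shows "pmf (grand_finals P recharge s t) t = (if recharge then (P t s)\<^sup>2 else P t s)"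
  using assms
  by (simp add: grand_finals_def match_def map_pmf_def pmf_bernoulli_bind bind_assoc_pmf
      bind_return_pmf) (simp add: power2_eq_square algebra_simps)

lemma pmf_grand_finals_other:
  assumes "a \<noteq> t" "b \<noteq> t"
  shows "pmf (grand_finals P recharge a b) t = 0"
proof -
  have "t \<notin> set_pmf (grand_finals P recharge a b)"
    using assms by (auto simp: grand_finals_def match_def simp del: set_pmf_bernoulli split: if_splits)
  then show ?thesis
    by (simp add: set_pmf_iff)
qed

text \<open>Each term is at most the whole sum, so every exponent \<open>m k\<close> is at least
  \<open>n\<close>. Since \<open>2 * p > 1\<close>, the factor \<open>(2 * p) ^ m k\<close> by which
  \<open>p ^ m k\<close> exceeds \<open>(1 / 2) ^ m k\<close> is then at least
  \<open>(2 * p) ^ n\<close>.\<close>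

lemma sum_power_ge_of_sum_half_power:
  fixes p :: real and m :: "'i \<Rightarrow> nat"
  assumes "finite I" and "1 / 2 < p" "p < 1" and sum: "(\<Sum>k\<in>I. (1 / 2 :: real) ^ m k) = (1 / 2) ^ n"
  shows "p ^ n \<le> (\<Sum>k\<in>I. p ^ m k)"
    and "card I \<ge> 2 \<Longrightarrow> p ^ n < (\<Sum>k\<in>I. p ^ m k)"
proof -
  have ge: "n \<le> m k" if "k \<in> I" for k
  proof -
    have "(1 / 2 :: real) ^ m k \<le> (1 / 2) ^ n"
      unfolding sum[symmetric] using that assms(1) by (intro member_le_sum) auto
    then show ?thesis by simp
  qed
  have term_eq: "p ^ m k = (2 * p) ^ m k * (1 / 2) ^ m k" for k
    by (subst power_mult_distrib[symmetric]) simp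
  have le: "(2 * p) ^ n * (1 / 2) ^ m k \<le> p ^ m k" if "k \<in> I" for k
    unfolding term_eq using ge[OF that] assms(2) by (intro mult_right_mono power_increasing) auto
  have pn: "p ^ n = (\<Sum>k\<in>I. (2 * p) ^ n * (1 / 2) ^ m k)"
    unfolding sum_distrib_left[symmetric] sum by (subst power_mult_distrib[symmetric]) simp
  show "p ^ n \<le> (\<Sum>k\<in>I. p ^ m k)"
    unfolding pn by (intro sum_mono le)
  assume "card I \<ge> 2"
  then obtain i j where ij: "i \<in> I" "j \<in> I" "i \<noteq> j"
    by (metis One_nat_def card_le_Suc0_iff_eq assms(1) not_less_eq_eq numeral_2_eq_2)
  \<comment> \<open>A second positive term keeps the term of \<open>i\<close> strictly below the
    sum, so \<open>m i > n\<close> and the comparison is strict at \<open>i\<close>.\<close>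
  have "(\<Sum>k\<in>{i, j}. (1 / 2 :: real) ^ m k) \<le> (1 / 2) ^ n"
    unfolding sum[symmetric] using ij assms(1) by (intro sum_mono2) auto
  moreover have "0 < (1 / 2 :: real) ^ m j"
    by simp
  moreover have "(\<Sum>k\<in>{i, j}. (1 / 2 :: real) ^ m k) = (1 / 2) ^ m i + (1 / 2) ^ m j"
    using ij by simp
  ultimately have "(1 / 2 :: real) ^ m i < (1 / 2) ^ n"
    by linarith
  then have "n < m i" by simp
  then have "(2 * p) ^ n * (1 / 2) ^ m i < p ^ m i"
    unfolding term_eq using assms(2) by (intro mult_strict_right_mono power_strict_increasing) auto
  then show "p ^ n < (\<Sum>k\<in>I. p ^ m k)"
    unfolding pn using ij assms(1) le by (intro sum_strict_mono_ex1) auto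
qed

section \<open>Depths of the starting lines of the losers' bracket\<close>

lemma respectful_line_depth:
  assumes "labelled_by B (games A)" "respectful A B"
    and "(q, g) \<in> set (starting_lines B)" "(q', g') \<in> set (starting_lines B)" "length g = length g'"
  shows "length q = length q'"
proof -
  have "g \<in> games A" "g' \<in> games A"
    using assms(1,3,4) by (force simp: labelled_by_def)+
  \<comment> \<open>Games at equal distance from the root form one round of \<open>A\<close>, which
    is a single node; both lines are entered by arrows from it.\<close>
  then have "arrow A B (Round 1 (round_of A g)) (entry_node 2 B q)"
    "arrow A B (Round 1 (round_of A g)) (entry_node 2 B q')"
    using arrow.intros(2)[of g A q B] arrow.intros(2)[of g' A q' B] assms(3-5)
    by (auto simp: round_of_def)
  then have "entry_node 2 B q = entry_node 2 B q'"
    using assms(2) unfolding respectful_def by blast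
  \<comment> \<open>The entry node determines the depth: the place node means depth 0, and for a
    round the subtraction from \<open>height B\<close> is not truncated because no line is deeper
    than \<open>height B\<close>.\<close>
  then show ?thesis
    using length_line_le_height[OF assms(3)] length_line_le_height[OF assms(4)]
      length_greater_0_conv[of q] length_greater_0_conv[of q']
    by (simp add: entry_node_def round_of_def split: if_splits del: length_greater_0_conv)
qed

text \<open>Kraft's sum is regrouped by the length \<open>k\<close> of the labels; there are
  \<open>2 ^ k\<close> boolean lists of length \<open>k\<close>.\<close>

lemma kraft_sum_by_round:
  assumes "labelled_by B {g :: bool list. length g < r}"
    and "\<And>q g. (q, g) \<in> set (starting_lines B) \<Longrightarrow> length q = dep (length g)"
  shows "(\<Sum>k<r. 2 ^ k * (1 / 2 :: real) ^ dep k) = 1"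
proof -
  have lines: "distinct (map snd (starting_lines B))"
    "set (map snd (starting_lines B)) = {g. length g < r}"
    using assms(1) by (auto simp: labelled_by_def)
  have fin: "finite {g :: bool list. length g < r}"
    unfolding lines(2)[symmetric] by (rule List.finite_set)
  have "1 = (\<Sum>(q, g) \<leftarrow> starting_lines B. (1 / 2 :: real) ^ length q)"
    by (simp add: kraft_sum_starting_lines)
  also have "\<dots> = (\<Sum>g \<leftarrow> map snd (starting_lines B). (1 / 2 :: real) ^ dep (length g))"
    using assms(2) by (auto simp: comp_def intro!: arg_cong[of _ _ sum_list])
  also have "\<dots> = (\<Sum>g\<in>{g :: bool list. length g < r}. (1 / 2) ^ dep (length g))"
    unfolding lines(2)[symmetric] by (rule sum.distinct_set_conv_list[OF lines(1), symmetric])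
  also have "\<dots> = (\<Sum>k<r. \<Sum>g | g \<in> {g :: bool list. length g < r} \<and> length g = k. (1 / 2) ^ dep (length g))"
    using fin by (intro sum.group[symmetric]) auto
  also have "\<dots> = (\<Sum>k<r. 2 ^ k * (1 / 2) ^ dep k)"
  proof (intro sum.cong refl)
    fix k assume "k \<in> {..<r}"
    then have *: "{g. g \<in> {g :: bool list. length g < r} \<and> length g = k} = {g :: bool list. set g \<subseteq> UNIV \<and> length g = k}"
      by auto
    show "(\<Sum>g | g \<in> {g :: bool list. length g < r} \<and> length g = k. (1 / 2) ^ dep (length g)) = 2 ^ k * (1 / 2 :: real) ^ dep k"
      unfolding * using card_lists_length_eq[of "UNIV :: bool set" k] by simp
  qed
  finally show ?thesis by simp
qed

lemma respectful_depth_by_round: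
  assumes "labelled_by B (games A)" "respectful A B"
  shows "\<exists>dep. \<forall>(q, g) \<in> set (starting_lines B). length q = dep (length g)"
proof -
  have "\<exists>n. \<forall>(q, g) \<in> set (starting_lines B). length g = k \<longrightarrow> length q = n" for k
  proof (cases "\<exists>(q, g) \<in> set (starting_lines B). length g = k")
    case True
    then obtain q g where "(q, g) \<in> set (starting_lines B)" "length g = k"
      by blast
    then show ?thesis
      using respectful_line_depth[OF assms, of _ _ q g] by blast
  qed blast
  then obtain dep where "\<And>k. \<forall>(q, g) \<in> set (starting_lines B). length g = k \<longrightarrow> length q = dep k"
    by metis
  then show ?thesis
    by blast
qed

section \<open>The losers' bracket together with the grand finals\<close>

lemma map_pmf_eq_bernoulli: "map_pmf (\<lambda>x. x = t) M = bernoulli_pmf (pmf M t)"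
  by (intro bernoulli_pmf_eqI pmf_nonneg pmf_le_1 pmf_map_eq_True)

text \<open>Recording only whether \<open>t\<close> is champion makes the law depend on the play of
  \<open>A\<close> through the games lost by \<open>t\<close> alone, although the opponents in the
  losers' bracket vary. It can therefore be composed with \<open>loss_pmf\<close>.\<close>

lemma losers_bracket_champion:
  fixes P :: "'t \<Rightarrow> 't \<Rightarrow> real" and B :: "bool list bracket"
  assumes inj: "inj_on f (dom f)" and lab: "labelled_by B (dom f)" and ran: "ran f = S - {a}"
    and "a \<in> S" "t \<in> S"
    and P: "\<And>s. s \<in> S \<Longrightarrow> s \<noteq> t \<Longrightarrow> P t s = p \<and> P s t = 1 - p"
    and p: "0 \<le> p" "p \<le> 1"
    and dep: "\<And>q g. (q, g) \<in> set (starting_lines B) \<Longrightarrow> length q = dep (length g)"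
  shows "map_pmf (\<lambda>x. x = t) (do {
           (b, _) \<leftarrow> play P (map_bracket (\<lambda>g. the (f g)) B);
           grand_finals P recharge a b
         }) = (if {g. f g = Some t} = {} then bernoulli_pmf (if recharge then 1 - (1 - p)\<^sup>2 else p)
         else bernoulli_pmf (p ^ dep (length (the_elem {g. f g = Some t})) * (if recharge then p\<^sup>2 else p)))"
proof -
  let ?B = "map_bracket (\<lambda>g. the (f g)) B"
  have snd_B: "map snd (starting_lines ?B) = map (\<lambda>g. the (f g)) (map snd (starting_lines B))"
    by (simp add: starting_lines_map_bracket comp_def)
  have "inj_on (\<lambda>g. the (f g)) (dom f)"
    using inj by (auto simp: inj_on_def dom_def)
  then have dist: "distinct (map snd (starting_lines ?B))"
    using lab unfolding snd_B labelled_by_def distinct_map[of "\<lambda>g. the (f g)"] by simp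
  have "set_bracket ?B = (\<lambda>g. the (f g)) ` dom f"
    using lab unfolding set_bracket_eq_lines snd_B labelled_by_def set_map[of "\<lambda>g. the (f g)"] by simp
  also have "\<dots> = ran f"
    by (force simp: ran_def dom_def image_iff)
  finally have set_B: "set_bracket ?B = S - {a}"
    using ran by simp
  have b: "b \<in> S - {a}" if "(b, h) \<in> set_pmf (play P ?B)" for b h
    using play_support[OF dist that] set_B by simp
  have t_ran: "{g. f g = Some t} = {} \<longleftrightarrow> a = t"
  proof -
    have "{g. f g = Some t} = {} \<longleftrightarrow> t \<notin> ran f"
      by (auto simp: ran_def)
    then show ?thesis using ran \<open>t \<in> S\<close> by auto
  qed
  show ?thesis
  proof (cases "a = t")
    case True
    \<comment> \<open>Every possible winner of the losers' bracket is a team that \<open>t\<close>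
      beats with probability \<open>p\<close>, so the play of that bracket does not affect the
      law.\<close>
    have "play P ?B \<bind> (\<lambda>x. map_pmf (\<lambda>x. x = t) (case x of (b, _) \<Rightarrow> grand_finals P recharge a b))
      = play P ?B \<bind> (\<lambda>_. bernoulli_pmf (if recharge then 1 - (1 - p)\<^sup>2 else p))"
    proof (intro bind_pmf_cong refl)
      fix x assume "x \<in> set_pmf (play P ?B)"
      then have "fst x \<in> S" "fst x \<noteq> t"
        using b[of "fst x" "snd x"] True by auto
      then show "map_pmf (\<lambda>x. x = t) (case x of (b, _) \<Rightarrow> grand_finals P recharge a b)
        = bernoulli_pmf (if recharge then 1 - (1 - p)\<^sup>2 else p)"
        using P[of "fst x"] p True
        by (simp add: split_beta map_pmf_eq_bernoulli pmf_grand_finals_unbeaten)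
    qed
    then show ?thesis
      using t_ran True by (simp add: map_bind_pmf)
  next
    case False
    then obtain g where g: "f g = Some t"
      using t_ran by auto
    then have L: "{g. f g = Some t} = {g}"
      using inj by (auto simp: inj_on_def dom_def)
    have "g \<in> set (map snd (starting_lines B))"
      using lab g by (auto simp: labelled_by_def)
    then obtain q where q: "(q, g) \<in> set (starting_lines B)"
      by auto
    then have qt: "(q, t) \<in> set (starting_lines ?B)"
      using g by (force simp: starting_lines_map_bracket)
    \<comment> \<open>If \<open>t\<close> does not win the losers' bracket either, neither finalist
      is \<open>t\<close>; this is the value 0.\<close>
    have K: "map_pmf (\<lambda>x. x = t) (grand_finals P recharge a b)
      = (if b = t then bernoulli_pmf (if recharge then p\<^sup>2 else p) else bernoulli_pmf 0)" for b
      using P[of a] p False \<open>a \<in> S\<close>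
      by (simp add: map_pmf_eq_bernoulli pmf_grand_finals_once_beaten pmf_grand_finals_other)
    have c: "0 \<le> (if recharge then p\<^sup>2 else p)" "(if recharge then p\<^sup>2 else p) \<le> 1"
      using p by (auto simp: power_le_one)
    have "map_pmf (\<lambda>x. x = t) (play P ?B \<bind> (\<lambda>(b, _). grand_finals P recharge a b))
      = play P ?B \<bind> (\<lambda>(b, _). map_pmf (\<lambda>x. x = t) (grand_finals P recharge a b))"
      by (auto simp: map_bind_pmf intro!: bind_pmf_cong)
    also have "\<dots> = bernoulli_pmf (p ^ dep (length g) * (if recharge then p\<^sup>2 else p))"
    proof (rule bernoulli_pmf_eqI)
      show "pmf (play P ?B \<bind> (\<lambda>(b, _). map_pmf (\<lambda>x. x = t) (grand_finals P recharge a b))) True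
        = p ^ dep (length g) * (if recharge then p\<^sup>2 else p)"
        using play_bind_winner[OF dist qt _ p K, of P] P set_B c dep[OF q] by simp
    qed (use p c in \<open>auto intro!: mult_nonneg_nonneg mult_le_one power_le_one\<close>)
    finally show ?thesis
      using L by simp
  qed
qed

section \<open>Comparison of the two winning probabilities\<close>

theorem theorem3p7p8:
  fixes r :: nat and p :: real and P :: "'t \<Rightarrow> 't \<Rightarrow> real"
    and T :: "'t list" and t :: 't
    and A :: "nat bracket" and B :: "bool list bracket" and recharge :: bool
  assumes "r > 0"
    and "1 / 2 < p" and "p < 1"
    and "length T = 2 ^ r" and "distinct T"
    and "matchup_probabilities P (set T)"
    and "t \<in> set T"
    and "\<And>s. s \<in> set T \<Longrightarrow> s \<noteq> t \<Longrightarrow> P t s = p"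
    and "balanced_bracket r A"
    and "linear_multibracket A B"
    and "respectful A B"
  shows "win_prob (double_elimination P recharge A B) t T \<ge> win_prob (bracket_format P A) t T
    \<and> (win_prob (double_elimination P recharge A B) t T = win_prob (bracket_format P A) t T
         \<longrightarrow> r = 1 \<and> \<not> recharge)"
proof -
  let ?A = "map_bracket (\<lambda>i. T ! i) A"
  \<comment> \<open>\<open>c1\<close> and \<open>c2\<close> are the chances of \<open>t\<close> in
    the grand finals as winner of \<open>A\<close> and as winner of \<open>B\<close>.\<close>
  define c1 where "c1 = (if recharge then 1 - (1 - p)\<^sup>2 else p)"
  define c2 where "c2 = (if recharge then p\<^sup>2 else p)"
  have p: "0 \<le> p" "p \<le> 1"
    using assms(2,3) by auto
  have c: "0 \<le> c1" "c1 \<le> 1" "0 \<le> c2" "c2 \<le> 1"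
    using p by (auto simp: c1_def c2_def power_le_one)
  have Pt: "P t s = p \<and> P s t = 1 - p" if "s \<in> set T" "s \<noteq> t" for s
    using assms(6,7) assms(8)[OF that] that unfolding matchup_probabilities_def by force
  have lines: "distinct (map snd (starting_lines A))" "set (map snd (starting_lines A)) = {..<2 ^ r}"
    and len: "\<And>q i. (q, i) \<in> set (starting_lines A) \<Longrightarrow> length q = r"
    using assms(9) by (auto simp: balanced_bracket_def labelled_by_def)
  have snd_A: "map snd (starting_lines ?A) = map (\<lambda>i. T ! i) (map snd (starting_lines A))"
    by (simp add: starting_lines_map_bracket comp_def)
  have "inj_on (\<lambda>i. T ! i) {..<2 ^ r}"
    using assms(4,5) by (auto simp: inj_on_def nth_eq_iff_index_eq)
  then have dist: "distinct (map snd (starting_lines ?A))"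
    using lines unfolding snd_A distinct_map[of "\<lambda>i. T ! i"] by simp
  have "set_bracket ?A = (\<lambda>i. T ! i) ` {..<2 ^ r}"
    using lines unfolding set_bracket_eq_lines snd_A set_map[of "\<lambda>i. T ! i"] by simp
  then have set_A: "set_bracket ?A = set T"
    using assms(4) by (auto simp: set_conv_nth)
  obtain i where i: "i < 2 ^ r" "t = T ! i"
    using assms(4,7) by (auto simp: in_set_conv_nth)
  then have "i \<in> set (map snd (starting_lines A))"
    unfolding lines by simp
  then obtain q where q: "(q, i) \<in> set (starting_lines A)"
    by auto
  have len_q: "length q = r"
    using q by (rule len)
  have qt: "(q, t) \<in> set (starting_lines ?A)"
    using q i by (force simp: starting_lines_map_bracket)
  have loss: "map_pmf (\<lambda>(a, f). {g. f g = Some t}) (play P ?A) = loss_pmf p q"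
    using dist qt Pt p by (intro map_play_losses) (auto simp: set_A)

  have "win_prob (bracket_format P A) t T = pmf (play P ?A \<bind> (\<lambda>(a, _). return_pmf (a = t))) True"
    unfolding win_prob_def bracket_format_def
    by (subst pmf_map_eq_True[symmetric]) (auto simp: map_pmf_def bind_assoc_pmf bind_return_pmf
        intro!: arg_cong[of _ _ "\<lambda>M. pmf M True"] bind_pmf_cong)
  also have "\<dots> = p ^ r"
    using play_bind_winner[OF dist qt _ p, of P "\<lambda>a. return_pmf (a = t)" "return_pmf True" "return_pmf False"]
    by (simp add: Pt set_A len_q)
  finally have WA: "win_prob (bracket_format P A) t T = p ^ r" .

  have games_A: "games A = {g. length g < r}"
    using games_uniform_depth[of A r] len by blast
  have lab: "labelled_by B (games A)"
    using assms(10) by (simp add: linear_multibracket_def)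
  obtain dep where "\<forall>(q, g) \<in> set (starting_lines B). length q = dep (length g)"
    using respectful_depth_by_round[OF lab assms(11)] by blast
  then have dep: "\<And>q g. (q, g) \<in> set (starting_lines B) \<Longrightarrow> length q = dep (length g)"
    by blast
  let ?N = "\<lambda>S. if S = {} then bernoulli_pmf c1
    else bernoulli_pmf (p ^ dep (length (the_elem S)) * c2)"
  have "map_pmf (\<lambda>x. x = t) (double_elimination P recharge A B T)
    = play P ?A \<bind> (\<lambda>x. ?N (case x of (a, f) \<Rightarrow> {g. f g = Some t}))"
    unfolding double_elimination_def map_bind_pmf
  proof (intro bind_pmf_cong refl)
    fix x assume "x \<in> set_pmf (play P ?A)"
    then obtain a f where x: "x = (a, f)" "(a, f) \<in> set_pmf (play P ?A)"
      by (cases x) auto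
    have f: "a \<in> set T" "dom f = games A" "ran f = set T - {a}" "inj_on f (dom f)"
      using play_support[OF dist x(2)] unfolding set_A games_map_bracket by blast+
    show "map_pmf (\<lambda>x. x = t) (case x of (a, loser) \<Rightarrow>
        play P (map_bracket (\<lambda>g. the (loser g)) B) \<bind> (\<lambda>(b, _). grand_finals P recharge a b))
      = ?N (case x of (a, f) \<Rightarrow> {g. f g = Some t})"
      unfolding x prod.case c1_def c2_def
      using lab f assms(7) Pt p dep by (intro losers_bracket_champion) auto
  qed
  also have "\<dots> = loss_pmf p q \<bind> ?N"
    by (simp only: loss[symmetric] bind_map_pmf)
  finally have "win_prob (double_elimination P recharge A B) t T = pmf (loss_pmf p q \<bind> ?N) True"
    unfolding win_prob_def by (metis pmf_map_eq_True)
  \<comment> \<open>In the summand, \<open>t\<close> wins \<open>r - Suc k\<close> games of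
    \<open>A\<close>, loses at distance \<open>k\<close> from the root, wins \<open>dep k\<close>
    games of \<open>B\<close> and then the grand finals.\<close>
  also have "\<dots> = p ^ r * c1 + (\<Sum>k<r. p ^ (r - Suc k) * (1 - p) * (p ^ dep k * c2))"
  proof -
    have "0 \<le> p ^ dep k * c2" "p ^ dep k * c2 \<le> 1" for k
      using p c by (auto intro!: mult_nonneg_nonneg mult_le_one power_le_one)
    then show ?thesis
      unfolding pmf_bind_loss_pmf[OF p] len_q using c by (simp add: len_q)
  qed
  also have "\<dots> = p ^ r * c1 + (1 - p) * c2 * (\<Sum>k<r. p ^ (r - Suc k + dep k))"
    unfolding sum_distrib_left power_add by (simp add: mult_ac)
  finally have WC: "win_prob (double_elimination P recharge A B) t T
    = p ^ r * c1 + (1 - p) * c2 * (\<Sum>k<r. p ^ (r - Suc k + dep k))" .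

  have "(\<Sum>k<r. 2 ^ k * (1 / 2 :: real) ^ dep k) = 1"
    using lab dep unfolding games_A by (rule kraft_sum_by_round)
  then have "(1 / 2 :: real) ^ (r - 1) = (\<Sum>k<r. (1 / 2) ^ (r - 1) * (2 ^ k * (1 / 2) ^ dep k))"
    by (simp only: sum_distrib_left[symmetric])
  also have "\<dots> = (\<Sum>k<r. (1 / 2) ^ (r - Suc k + dep k))"
  proof (intro sum.cong refl)
    fix k assume "k \<in> {..<r}"
    \<comment> \<open>As \<open>k < r\<close>, no subtraction is truncated, and
      \<open>(1 / 2) ^ k\<close> cancels the number \<open>2 ^ k\<close> of games at distance
      \<open>k\<close>.\<close>
    then have "r - 1 = (r - Suc k) + k" by auto
    then have "(1 / 2 :: real) ^ (r - 1) = (1 / 2) ^ (r - Suc k) * (1 / 2) ^ k"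
      by (simp only: power_add)
    then show "(1 / 2 :: real) ^ (r - 1) * (2 ^ k * (1 / 2) ^ dep k) = (1 / 2) ^ (r - Suc k + dep k)"
      unfolding power_add by (simp add: power_divide)
  qed
  finally have kraft: "(\<Sum>k<r. (1 / 2 :: real) ^ (r - Suc k + dep k)) = (1 / 2) ^ (r - 1)" ..
  define x where "x = p ^ (r - 1)"
  define s where "s = (\<Sum>k<r. p ^ (r - Suc k + dep k))"
  have "x > 0" using assms(2) by (simp add: x_def)
  have s_ge: "x \<le> s" and s_gt: "r \<ge> 2 \<Longrightarrow> x < s"
    unfolding x_def s_def
    using sum_power_ge_of_sum_half_power[OF _ assms(2,3) kraft] by simp_all
  have pr: "p ^ r = p * x"
    using assms(1) by (cases r) (simp_all add: x_def)
  show ?thesis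
  proof (cases recharge)
    case True
    \<comment> \<open>With \<open>s\<close> replaced by its lower bound \<open>x\<close>, the gain
      is already positive because \<open>2 * p > 1\<close>; a recharge round thus gives strictness
      for every \<open>r\<close>.\<close>
    have "p * x < p * x + p * x * (1 - p) * (2 * p - 1)"
      using assms(2,3) \<open>x > 0\<close> by simp
    also have "\<dots> = p * x * c1 + (1 - p) * c2 * x"
      using True by (simp add: c1_def c2_def power2_eq_square algebra_simps)
    also have "\<dots> \<le> p * x * c1 + (1 - p) * c2 * s"
      using s_ge p c by (intro add_left_mono mult_left_mono) auto
    finally show ?thesis
      unfolding WA WC pr s_def[symmetric] by simp
  next
    case False
    \<comment> \<open>The difference is a positive multiple of \<open>s - x\<close>, so equality
      forces \<open>s = x\<close>, which \<open>s_gt\<close> excludes for \<open>r\<close> at least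
      2.\<close>
    have diff: "p * x * c1 + (1 - p) * c2 * s - p * x = (1 - p) * p * (s - x)"
      using False by (simp add: c1_def c2_def algebra_simps)
    have "0 \<le> (1 - p) * p * (s - x)"
      using s_ge p by simp
    moreover have "(1 - p) * p * (s - x) = 0 \<Longrightarrow> r = 1"
      using s_gt assms(1-3) by (cases "r \<ge> 2") auto
    ultimately show ?thesis
      unfolding WA WC pr s_def[symmetric] using False diff by auto
  qed
qed

end
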